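(* Let $m\ge 1$ and let $v=(v_1,v_2,\dots,v_m)$ be a vector of positive integers in the permutation class defined by the permutation $\pi=[\pi_1\pi_2\cdots\pi_m]$ of $\{1,\dots,m\}$. Set $\gamma_1=0$ and, for $2\le i\le m$, set $\gamma_i=0$ if $\pi_{i-1}<\pi_i$ and $\gamma_i=1$ if $\pi_{i-1}>\pi_i$. Also set $$u_i=\left\lfloor\frac{v_i-1}{i}\right\rfloor\qquad(1\le i\le m).$$ Then $(v_1,\dots,v_m)$ is the position vector (with respect to $m+1$) of a numerical semigroup containing $m+1$ if and only if $$\sum_{x=1}^i (u_x+\gamma_x)+\frac{\pi_i+\pi_j-\pi_l}{m+1}\ \ge\ \sum_{x=j+1}^l (u_x+\gamma_x)$$ for all indices $1\le i\le j<l\le m$ with $\pi_i+\pi_j\equiv\pi_l \pmod{m+1}$.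
   Context: A numerical semigroup is a subset $S$ of the nonnegative integers $\mathbb{N}_0$ that contains $0$, is closed under addition, and has finite complement in $\mathbb{N}_0$. Position vector: for a numerical semigroup $S$ containing a positive integer $n$, the Apéry set is $\mathrm{Ap}(S,n)=\{w\in S: w-n\notin S\}$, which has exactly $n$ elements, including $0$. Enumerate $S=\{\lambda_0,\lambda_1,\lambda_2,\dots\}$ in increasing order and write $\mathrm{Ap}(S,n)=\{\lambda_0,\lambda_{x_1},\dots,\lambda_{x_{n-1}}\}$ with $0<x_1<\dots<x_{n-1}$. The position vector of $S$ with respect to $n$ is the $(n-1)$-tuple $\mathrm{pv}_n(S)=(x_1,\,x_2-x_1,\dots,x_{n-1}-x_{n-2})$. A vector of length $m$ is regarded as a position vector with respect to $n=m+1$. Conversion vector: for a permutation $\pi=[\pi_1\cdots\pi_m]$ of $\{1,\dots,m\}$ (one-line notation), its conversion vector is $(r_1,\dots,r_m)$ with $r_i=|\{j: j<i\text{ and }\pi_j<\pi_i\}|$. Every vector of integers with $0\le r_i\le i-1$ for all $i$ is the conversion vector of a unique permutation. Permutation class: for a vector $v=(v_1,\dots,v_m)$ of positive integers, put $t_1=0$ and $t_i=(v_i+t_{i-1})\bmod i\in\{0,\dots,i-1\}$ for $2\le i\le m$. The permutation associated with $v$ is the unique permutation $\pi$ of $\{1,\dots,m\}$ with conversion vector $(t_1,\dots,t_m)$, and $v$ is said to be in the permutation class defined by $\pi$. *)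

theory Defs
  imports Complex_Main "HOL-Library.Infinite_Set" "HOL-Combinatorics.Permutations"
    "HOL-Number_Theory.Cong"
begin

(* Vectors of length m and permutations of {1..m} are functions indexed by 1, ..., m.
   Values of a vector outside {1..m} are irrelevant. *)

definition numerical_semigroup :: "nat set \<Rightarrow> bool" where
  "numerical_semigroup S \<longleftrightarrow>
     0 \<in> S \<and> (\<forall>a\<in>S. \<forall>b\<in>S. a + b \<in> S) \<and> finite (UNIV - S)"

(* The difference w - n is taken in the integers. *)
definition Apery :: "nat set \<Rightarrow> nat \<Rightarrow> nat set" where
  "Apery S n = {w \<in> S. int w - int n \<notin> int ` S}"

(* enumerate S k is lambda_k, counting from lambda_0 = 0. *)
definition Apery_positions :: "nat set \<Rightarrow> nat \<Rightarrow> nat set" where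
  "Apery_positions S n = {k. enumerate S k \<in> Apery S n}"

(* The indices 0 = x_0 < x_1 < ... < x_(n-1).  The set of positions is finite, and
   enumerate is meaningful for indices below its cardinality, i.e. for i < n. *)
definition Apery_index :: "nat set \<Rightarrow> nat \<Rightarrow> nat \<Rightarrow> nat" where
  "Apery_index S n i = enumerate (Apery_positions S n) i"

(* Entry i, for 1 <= i <= n - 1; as x_0 = 0, entry 1 is x_1. *)
definition position_vector :: "nat set \<Rightarrow> nat \<Rightarrow> nat \<Rightarrow> nat" where
  "position_vector S n i = Apery_index S n i - Apery_index S n (i - 1)"

definition conversion_vector :: "(nat \<Rightarrow> nat) \<Rightarrow> nat \<Rightarrow> nat" where
  "conversion_vector \<pi> i = card {j. 1 \<le> j \<and> j < i \<and> \<pi> j < \<pi> i}"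

(* The value at 0 is a dummy; the recursion starts with t_1 = 0. *)
fun class_vector :: "(nat \<Rightarrow> nat) \<Rightarrow> nat \<Rightarrow> nat" where
  "class_vector v 0 = 0"
| "class_vector v (Suc 0) = 0"
| "class_vector v (Suc (Suc k)) = (v (Suc (Suc k)) + class_vector v (Suc k)) mod Suc (Suc k)"

(* As a permutation is determined by its conversion vector, at most one \<pi> has this property. *)
definition in_permutation_class :: "nat \<Rightarrow> (nat \<Rightarrow> nat) \<Rightarrow> (nat \<Rightarrow> nat) \<Rightarrow> bool" where
  "in_permutation_class m v \<pi> \<longleftrightarrow>
     \<pi> permutes {1..m} \<and> (\<forall>i\<in>{1..m}. conversion_vector \<pi> i = class_vector v i)"

definition gamma_descent :: "(nat \<Rightarrow> nat) \<Rightarrow> nat \<Rightarrow> int" where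
  "gamma_descent \<pi> i = (if 2 \<le> i \<and> \<pi> (i - 1) > \<pi> i then 1 else 0)"

definition u_quot :: "(nat \<Rightarrow> nat) \<Rightarrow> nat \<Rightarrow> int" where
  "u_quot v i = \<lfloor>(real (v i) - 1) / real i\<rfloor>"

end

theory Submission
  imports Defs
begin

text \<open>
  Write \<open>n = m + 1\<close>. A numerical semigroup \<open>S\<close> that contains \<open>n\<close> is the union of the progressions
  \<open>w\<^sub>k + n \<nat>\<close>, where \<open>0 = w\<^sub>0 < \<dots> < w\<^sub>m\<close> are its Apery elements, one in each residue class modulo
  \<open>n\<close>. Write \<open>w\<^sub>k = n q\<^sub>k + p\<^sub>k\<close> with \<open>0 \<le> p\<^sub>k < n\<close>. The position \<open>x\<^sub>i\<close> of \<open>w\<^sub>i\<close> in \<open>S\<close> is the number of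
  elements of \<open>S\<close> below \<open>w\<^sub>i\<close>, and the progression of an earlier \<open>w\<^sub>k\<close> contributes \<open>q\<^sub>i - q\<^sub>k\<close> of
  them, plus one more if \<open>p\<^sub>k < p\<^sub>i\<close>. With \<open>r\<close> the conversion vector of \<open>p\<close>, summing over \<open>k < i\<close> gives
  \<open>x\<^sub>i = i q\<^sub>i - (q\<^sub>0 + \<dots> + q\<^bsub>i-1\<^esub>) + r\<^sub>i + 1\<close>, the final 1 coming from \<open>k = 0\<close>. Hence the position
  vector has \<open>v\<^sub>1 = q\<^sub>1 + 1\<close> and

    \<open>v\<^sub>i = i (q\<^sub>i - q\<^bsub>i-1\<^esub>) + r\<^sub>i - r\<^bsub>i-1\<^esub>\<close> for \<open>i \<ge> 2\<close>

  (lemmas \<open>position_vector_1\<close> and \<open>position_vector_step\<close>).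

  Modulo \<open>i\<close> this is the recursion for the permutation class, so \<open>r\<close> is the conversion vector of
  \<open>\<pi>\<close> and therefore \<open>p = \<pi>\<close>. On the level of quotients, \<open>r\<^sub>i - r\<^bsub>i-1\<^esub> - 1\<close> lies in \<open>{0..<i}\<close> at an
  ascent of \<open>\<pi>\<close> and in \<open>{-i..<0}\<close> at a descent, so \<open>q\<^sub>i - q\<^bsub>i-1\<^esub> = u\<^sub>i + \<gamma>\<^sub>i\<close> (lemma
  \<open>quotient_step\<close>). Thus \<open>v\<close> and \<open>\<pi>\<close> determine the only possible list:
  \<open>w\<^sub>i = n (\<Sum>x\<le>i. u\<^sub>x + \<gamma>\<^sub>x) + \<pi>\<^sub>i\<close>. This list is always increasing with distinct residues, and the
  union of its progressions has \<open>v\<close> as its position vector whether or not it is closed under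
  addition. So \<open>v\<close> is realizable if and only if this union is a semigroup, that is, if and only if
  \<open>w\<^sub>l \<le> w\<^sub>i + w\<^sub>j\<close> whenever \<open>w\<^sub>i + w\<^sub>j\<close> is in the residue class of \<open>w\<^sub>l\<close>. By monotonicity only
  \<open>i \<le> j < l\<close> matters, and dividing by \<open>n\<close> yields the stated inequalities.
\<close>

section \<open>Enumerations and arithmetic progressions\<close>

lemma enumerate_strict_mono_image:
  fixes f :: "nat \<Rightarrow> nat"
  assumes "strict_mono_on {..m} f" "i \<le> m"
  shows "enumerate (f ` {..m}) i = f i"
  using assms
proof (induction i arbitrary: f m)
  case 0
  then show ?case
    by (auto simp: enumerate_0 intro!: Least_equality dest: strict_mono_on_imp_mono_on monotone_onD)
next
  case (Suc i)
  then obtain k where k: "m = Suc k"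
    by (cases m) auto
  have mono: "f x < f y" if "x < y" "y \<le> m" for x y
    using Suc.prems(1) that by (auto simp: strict_mono_on_def)
  have least: "enumerate (f ` {..m}) 0 = f 0"
    using Suc.prems(1)
    by (auto simp: enumerate_0 intro!: Least_equality dest: strict_mono_on_imp_mono_on monotone_onD)
  have "{..m} = insert 0 (Suc ` {..k})"
    using k by (simp add: atMost_Suc_eq_insert_0)
  moreover have "f 0 \<notin> f ` Suc ` {..k}"
    using mono[of 0] k by force
  ultimately have "f ` {..m} - {f 0} = (f \<circ> Suc) ` {..k}"
    by (simp add: image_comp)
  moreover have "strict_mono_on {..k} (f \<circ> Suc)"
    by (intro strict_mono_onI) (auto simp: k intro: mono)
  ultimately show ?case
    using Suc.IH[of k "f \<circ> Suc"] Suc.prems(2) least by (simp only: enumerate_Suc') (simp add: k)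
qed

lemma card_below_enumerate:
  fixes S :: "nat set"
  assumes "infinite S"
  shows "card {s \<in> S. s < enumerate S k} = k"
proof -
  have "{s \<in> S. s < enumerate S k} = enumerate S ` {..<k}"
    using assms enumerate_Ex[OF assms] enumerate_in_set[OF assms] by (fastforce simp: image_iff)
  then show ?thesis
    using inj_enumerate[OF assms] by (simp add: card_image inj_on_subset)
qed

lemma lex_less_iff:
  fixes n :: nat
  assumes "r < n" "s < n"
  shows "x * n + r < y * n + s \<longleftrightarrow> x < y \<or> x = y \<and> r < s"
proof -
  have "a * n + b < c * n + d" if "a < c" "b < n" for a b c d
  proof -
    have "a * n + b < Suc a * n" using that by simp
    also have "\<dots> \<le> c * n" using that by (intro mult_le_mono1) simp
    finally show ?thesis by simp
  qed
  from this[of x y r s] this[of y x s r] assms show ?thesis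
    by (cases x y rule: linorder_cases) auto
qed

text \<open>The length of the part of a progression below \<open>b\<close> is the ceiling of \<open>(b - a) / n\<close>.
  Splitting it into quotients and a comparison of residues is what later brings in the conversion
  vector.\<close>

lemma card_progression_below:
  fixes a b n :: nat
  assumes "a < b" "n > 0"
  shows "int (card {c. a + c * n < b}) =
    int (b div n) - int (a div n) + (if a mod n < b mod n then 1 else 0)"
proof -
  \<comment> \<open>Comparing quotients first and residues second, \<open>?N\<close> is the least quotient that is
    too large.\<close>
  let ?N = "(if a mod n < b mod n then Suc (b div n) else b div n)"
  have "a + c * n < b \<longleftrightarrow> c < ?N - a div n" for c
  proof -
    have "a + c * n = (a div n + c) * n + a mod n"
      by (simp add: algebra_simps)
    moreover have "b = b div n * n + b mod n"
      by simp
    ultimately have "a + c * n < b \<longleftrightarrow>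
        a div n + c < b div n \<or> a div n + c = b div n \<and> a mod n < b mod n"
      using lex_less_iff[of "a mod n" n "b mod n" "a div n + c" "b div n"] assms(2)
      by simp
    then show ?thesis by auto
  qed
  then have "{c. a + c * n < b} = {..<?N - a div n}" by auto
  moreover have "a div n \<le> b div n"
    using assms by (simp add: div_le_mono)
  ultimately show ?thesis by auto
qed

section \<open>Conversion vectors\<close>

lemma conversion_vector_cong:
  assumes "\<And>j. 1 \<le> j \<Longrightarrow> j \<le> i \<Longrightarrow> p j = r j" "1 \<le> i"
  shows "conversion_vector p i = conversion_vector r i"
proof -
  have "{j. 1 \<le> j \<and> j < i \<and> p j < p i} = {j. 1 \<le> j \<and> j < i \<and> r j < r i}"
    using assms by auto
  then show ?thesis by (simp add: conversion_vector_def)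
qed

lemma conversion_vector_le: "1 \<le> i \<Longrightarrow> conversion_vector p i \<le> i - 1"
proof -
  assume "1 \<le> i"
  have "card {j. 1 \<le> j \<and> j < i \<and> p j < p i} \<le> card {1..<i}"
    by (intro card_mono) auto
  then show ?thesis by (simp add: conversion_vector_def)
qed

lemma conversion_vector_ascent:
  assumes "2 \<le> i" "p (i - 1) < p i"
  shows "conversion_vector p (i - 1) < conversion_vector p i"
  unfolding conversion_vector_def
proof (intro psubset_card_mono psubsetI)
  have "i - 1 \<in> {j. 1 \<le> j \<and> j < i \<and> p j < p i}"
    using assms by auto
  then show "{j. 1 \<le> j \<and> j < i - 1 \<and> p j < p (i - 1)} \<noteq> {j. 1 \<le> j \<and> j < i \<and> p j < p i}"
    by blast
qed (use assms in auto)

lemma conversion_vector_descent: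
  assumes "2 \<le> i" "p i < p (i - 1)"
  shows "conversion_vector p i \<le> conversion_vector p (i - 1)"
  unfolding conversion_vector_def
proof (intro card_mono subsetI)
  fix j assume "j \<in> {j. 1 \<le> j \<and> j < i \<and> p j < p i}"
  moreover from this have "j \<noteq> i - 1"
    using assms by auto
  ultimately show "j \<in> {j. 1 \<le> j \<and> j < i - 1 \<and> p j < p (i - 1)}"
    using assms by auto
qed auto

text \<open>By induction on the number of positions: an initial segment of a finite linear order is determined
  by its size, so the rank of each new value among the earlier ones fixes all comparisons with it.\<close>

lemma conversion_vector_determines_order:
  fixes p r :: "nat \<Rightarrow> nat"
  assumes "inj_on p {1..m}" "inj_on r {1..m}"
    and conv: "\<And>i. i \<in> {1..m} \<Longrightarrow> conversion_vector p i = conversion_vector r i"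
    and "i \<in> {1..m}" "j \<in> {1..m}"
  shows "p i < p j \<longleftrightarrow> r i < r j"
proof -
  have "k \<le> m \<Longrightarrow> \<forall>i\<in>{1..k}. \<forall>j\<in>{1..k}. p i < p j \<longleftrightarrow> r i < r j" for k
  proof (induction k)
    case (Suc k)
    then have IH: "p i < p j \<longleftrightarrow> r i < r j" if "i \<in> {1..k}" "j \<in> {1..k}" for i j
      using that by simp
    \<comment> \<open>The new value is compared with the old ones by the set of old positions below it; only the
      size of that set is given.\<close>
    define A B where "A = {j \<in> {1..k}. p j < p (Suc k)}" and "B = {j \<in> {1..k}. r j < r (Suc k)}"
    have "card A = card B"
      using conv[of "Suc k"] Suc.prems
      by (simp add: conversion_vector_def A_def B_def less_Suc_eq_le conj_assoc)
    \<comment> \<open>Both are initial segments of the first \<open>k\<close> positions, for the one order that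
      both functions induce there.\<close>
    moreover have "A \<subseteq> B \<or> B \<subseteq> A"
    proof (rule ccontr)
      assume "\<not> (A \<subseteq> B \<or> B \<subseteq> A)"
      then obtain a b where "a \<in> A" "a \<notin> B" "b \<in> B" "b \<notin> A" by blast
      then have "a \<in> {1..k}" "b \<in> {1..k}" "p a < p b" "r b < r a"
        by (auto simp: A_def B_def)
      then show False using IH[of a b] by simp
    qed
    moreover have "finite A" "finite B"
      by (simp_all add: A_def B_def)
    ultimately have AB: "A = B"
      by (metis card_subset_eq)
    have new: "p i < p (Suc k) \<longleftrightarrow> r i < r (Suc k)" if "i \<in> {1..k}" for i
      using AB that unfolding A_def B_def by blast
    have new': "p (Suc k) < p i \<longleftrightarrow> r (Suc k) < r i" if "i \<in> {1..k}" for i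
    proof -
      have "p i \<noteq> p (Suc k)" "r i \<noteq> r (Suc k)"
        using assms(1,2) Suc.prems that by (auto dest!: inj_onD)
      then show ?thesis using new[OF that] by linarith
    qed
    have "{1..Suc k} = insert (Suc k) {1..k}" by auto
    then show ?case
      using IH new new' by simp
  qed simp
  then show ?thesis using assms by blast
qed

lemma conversion_vector_determines_permutation:
  fixes p r :: "nat \<Rightarrow> nat"
  assumes "bij_betw p {1..m} {1..m}" "bij_betw r {1..m} {1..m}"
    and "\<And>i. i \<in> {1..m} \<Longrightarrow> conversion_vector p i = conversion_vector r i"
    and "i \<in> {1..m}"
  shows "p i = r i"
proof -
  \<comment> \<open>A value of a permutation is recovered from its rank.\<close>
  have rank: "card {j \<in> {1..m}. f j < f i} = f i - 1" if "bij_betw f {1..m} {1..m}" for f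
  proof -
    have "f ` {j \<in> {1..m}. f j < f i} = {1..<f i}"
    proof -
      have "f ` {1..m} = {1..m}" using that by (simp add: bij_betw_def)
      moreover from this have "f i \<in> {1..m}" using assms(4) by blast
      moreover have "f ` {j \<in> {1..m}. f j < f i} = f ` {1..m} \<inter> {..<f i}" by blast
      ultimately show ?thesis by auto
    qed
    moreover have "inj_on f {j \<in> {1..m}. f j < f i}"
      using that by (auto simp: bij_betw_def intro: inj_on_subset)
    ultimately have "card {j \<in> {1..m}. f j < f i} = card {1..<f i}"
      by (metis card_image)
    then show ?thesis by simp
  qed
  have "{j \<in> {1..m}. p j < p i} = {j \<in> {1..m}. r j < r i}"
    using conversion_vector_determines_order[of p m r _ i] assms by (auto simp: bij_betw_def)
  then have "p i - 1 = r i - 1"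
    using rank[of p] rank[of r] assms(1,2) by simp
  moreover have "p i \<in> {1..m}" "r i \<in> {1..m}"
    using assms by (auto dest: bij_betwE)
  ultimately show ?thesis by auto
qed

text \<open>The recursion fixes \<open>t i\<close> modulo \<open>i\<close>, and the bound \<open>t i < i\<close> selects the residue.\<close>

lemma class_vector_unique:
  assumes "1 \<le> m" and "t 1 = 0"
    and "\<And>i. 2 \<le> i \<Longrightarrow> i \<le> m \<Longrightarrow> t i < i \<and> [v i + t (i - 1) = t i] (mod i)"
    and "1 \<le> i" "i \<le> m"
  shows "t i = class_vector v i"
  using assms(4,5)
proof (induction i rule: dec_induct)
  case base
  then show ?case using assms(2) by simp
next
  case (step k)
  obtain l where l: "k = Suc l" using step.hyps by (cases k) auto
  have "t (Suc k) < Suc k" "(v (Suc k) + t k) mod Suc k = t (Suc k) mod Suc k"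
    using assms(3)[of "Suc k"] step by (auto simp: cong_def simp del: mod_Suc)
  moreover have "t k = class_vector v k"
    using step by simp
  ultimately show ?case
    by (simp add: l)
qed

lemma class_vector_cong:
  assumes "2 \<le> i"
  shows "[v i + class_vector v (i - 1) = class_vector v i] (mod i)"
proof -
  obtain k where "i = Suc (Suc k)"
    using assms by (metis add_2_eq_Suc le_Suc_ex)
  then show ?thesis by (simp add: cong_def)
qed

text \<open>An arbitrary vector in the class already has the shape that position vectors have; the
  factor \<open>a\<close> is identified as a difference of consecutive quotients by \<open>quotient_step\<close> below.\<close>

lemma entry_of_permutation_class:
  assumes "in_permutation_class m v \<pi>" "2 \<le> i" "i \<le> m"
  shows "\<exists>a. int (v i) = int i * a + int (conversion_vector \<pi> i) - int (conversion_vector \<pi> (i - 1))"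
proof -
  have "i \<in> {1..m}" "i - 1 \<in> {1..m}"
    using assms(2,3) by auto
  then have "conversion_vector \<pi> i = class_vector v i"
    "conversion_vector \<pi> (i - 1) = class_vector v (i - 1)"
    using assms(1) unfolding in_permutation_class_def by blast+
  then have "[v i + conversion_vector \<pi> (i - 1) = conversion_vector \<pi> i] (mod i)"
    using class_vector_cong[OF assms(2), of v] by simp
  then have "[int (v i + conversion_vector \<pi> (i - 1)) = int (conversion_vector \<pi> i)] (mod int i)"
    by (simp only: cong_int_iff)
  then have "int i dvd int (v i + conversion_vector \<pi> (i - 1)) - int (conversion_vector \<pi> i)"
    by (simp only: cong_iff_dvd_diff)
  then obtain a where "int (v i + conversion_vector \<pi> (i - 1)) - int (conversion_vector \<pi> i) = int i * a"
    by (elim dvdE)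
  then show ?thesis by (intro exI[of _ a]) simp
qed

section \<open>Levels: the quotients of the Apery elements\<close>

lemma u_quot_1: "u_quot v 1 = int (v 1) - 1"
proof -
  have "u_quot v 1 = \<lfloor>real_of_int (int (v 1) - 1)\<rfloor>"
    by (simp add: u_quot_def)
  then show ?thesis by (simp only: floor_of_int)
qed

lemma gamma_descent_1: "gamma_descent p 1 = 0"
  by (simp add: gamma_descent_def)

text \<open>The descent indicator is the carry of the division: the difference of two consecutive conversion
  entries, less 1, is a remainder modulo \<open>i\<close> at an ascent and a remainder minus \<open>i\<close> at a descent.\<close>

lemma quotient_step:
  assumes "2 \<le> i" and "p (i - 1) \<noteq> p i"
    and "int (v i) = int i * a + int (conversion_vector p i) - int (conversion_vector p (i - 1))"
  shows "u_quot v i + gamma_descent p i = a"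
proof -
  define d where "d = int (conversion_vector p i) - int (conversion_vector p (i - 1)) - 1"
  have "u_quot v i = \<lfloor>of_int (int (v i) - 1) / (of_int (int i) :: real)\<rfloor>"
    by (simp add: u_quot_def)
  also have "\<dots> = (int (v i) - 1) div int i"
    by (rule floor_divide_of_int_eq)
  also have "int (v i) - 1 = d + a * int i"
    using assms(3) by (simp add: d_def)
  also have "(d + a * int i) div int i = d div int i + a"
    using assms(1) by simp
  finally have u: "u_quot v i = d div int i + a" .
  \<comment> \<open>It remains to place \<open>d\<close> in \<open>{0..<i}\<close> at an ascent and in \<open>{-i..<0}\<close> at a descent.\<close>
  have bounds: "conversion_vector p i \<le> i - 1" "conversion_vector p (i - 1) \<le> i - 2"
    using conversion_vector_le[of i p] conversion_vector_le[of "i - 1" p] assms(1)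
    by (simp_all add: numeral_2_eq_2)
  show ?thesis
  proof (cases "p (i - 1) < p i")
    case True
    then have "0 \<le> d" "d < int i"
      using conversion_vector_ascent[of i p] bounds assms(1) by (auto simp: d_def)
    then show ?thesis
      using u True by (simp add: gamma_descent_def)
  next
    case False
    then have less: "p i < p (i - 1)"
      using assms(2) by simp
    then have "0 \<le> d + int i" "d + int i < int i"
      using conversion_vector_descent[of i p] bounds assms(1) by (auto simp: d_def)
    then have "(d + int i) div int i = 0"
      by simp
    then have "d div int i = -1"
      using assms(1) by simp
    then show ?thesis
      using u less assms(1) by (simp add: gamma_descent_def)
  qed
qed

text \<open>The partial sums in the inequalities; they turn out to be the quotients of the Apery elements by
  \<open>m + 1\<close>.\<close>

definition level :: "(nat \<Rightarrow> nat) \<Rightarrow> (nat \<Rightarrow> nat) \<Rightarrow> nat \<Rightarrow> int" where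
  "level v p i = (\<Sum>x = 1..i. u_quot v x + gamma_descent p x)"

lemma level_0 [simp]: "level v p 0 = 0"
  by (simp add: level_def)

lemma level_step: "1 \<le> i \<Longrightarrow> level v p i = level v p (i - 1) + (u_quot v i + gamma_descent p i)"
  by (cases i) (simp_all add: level_def)

lemma level_unique:
  assumes "f 0 = 0"
    and "\<And>i. 1 \<le> i \<Longrightarrow> i \<le> m \<Longrightarrow> f i - f (i - 1) = u_quot v i + gamma_descent p i"
  shows "i \<le> m \<Longrightarrow> f i = level v p i"
proof (induction i)
  case (Suc i)
  then show ?case using assms(2)[of "Suc i"] level_step[of "Suc i" v p] by simp
qed (simp add: assms(1))

lemma sum_eq_level_diff:
  assumes "j \<le> l"
  shows "(\<Sum>x = j + 1..l. u_quot v x + gamma_descent p x) = level v p l - level v p j"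
proof -
  have "{1..l} = {1..j} \<union> {j + 1..l}" using assms by auto
  then have "level v p l = level v p j + (\<Sum>x = j + 1..l. u_quot v x + gamma_descent p x)"
    unfolding level_def by (simp add: sum.union_disjoint)
  then show ?thesis by simp
qed

lemma level_increment:
  assumes "v i > 0" "1 \<le> i"
  shows "level v p (i - 1) \<le> level v p i"
    and "2 \<le> i \<Longrightarrow> p i < p (i - 1) \<Longrightarrow> level v p (i - 1) < level v p i"
proof -
  have "0 \<le> u_quot v i"
    using assms by (simp add: u_quot_def)
  then show "level v p (i - 1) \<le> level v p i"
    and "2 \<le> i \<Longrightarrow> p i < p (i - 1) \<Longrightarrow> level v p (i - 1) < level v p i"
    using level_step[OF assms(2), of v p] by (auto simp: gamma_descent_def)
qed

section \<open>Sets with prescribed Apery elements\<close>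

text \<open>A union of progressions starting at an increasing list of residue representatives. Closure under
  addition is not part of the notion: Apery elements and positions are computed without it, so the
  closure condition can be treated afterwards as a separate question about the list.\<close>

locale apery_list =
  fixes m :: nat and w :: "nat \<Rightarrow> nat" and S :: "nat set"
  assumes w_0: "w 0 = 0"
    and w_strict_mono: "strict_mono_on {..m} w"
    and residues_bij: "bij_betw (\<lambda>i. w i mod (m + 1)) {..m} {..m}"
    and mem_iff: "s \<in> S \<longleftrightarrow> (\<exists>k\<le>m. \<exists>c. s = w k + c * (m + 1))"
begin

lemma w_less_iff: "i \<le> m \<Longrightarrow> j \<le> m \<Longrightarrow> w i < w j \<longleftrightarrow> i < j"
  using w_strict_mono by (simp add: strict_mono_on_less)

lemma same_residue_iff: "i \<le> m \<Longrightarrow> j \<le> m \<Longrightarrow> w i mod (m + 1) = w j mod (m + 1) \<longleftrightarrow> i = j"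
  using inj_on_eq_iff[OF bij_betw_imp_inj_on[OF residues_bij]] by simp

lemma mem_iff_residue:
  assumes "k \<le> m" "s mod (m + 1) = w k mod (m + 1)"
  shows "s \<in> S \<longleftrightarrow> w k \<le> s"
proof
  assume "s \<in> S"
  then obtain j c where j: "j \<le> m" "s = w j + c * (m + 1)"
    using mem_iff by auto
  then have "w j mod (m + 1) = w k mod (m + 1)"
    using assms(2) by (metis mod_mult_self1)
  then show "w k \<le> s"
    using j assms(1) same_residue_iff by simp
next
  assume "w k \<le> s"
  then have "(m + 1) dvd s - w k"
    using assms(2) by (metis mod_eq_dvd_iff_nat)
  then obtain c where "s - w k = (m + 1) * c" by (auto elim: dvdE)
  then have "s = w k + c * (m + 1)"
    using \<open>w k \<le> s\<close> by (simp add: mult.commute)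
  then show "s \<in> S" using mem_iff assms(1) by blast
qed

lemma ex_index_of_residue: "\<exists>k\<le>m. s mod (m + 1) = w k mod (m + 1)"
proof -
  have "s mod (m + 1) \<in> (\<lambda>i. w i mod (m + 1)) ` {..m}"
    using residues_bij by (simp add: bij_betw_def less_Suc_eq_le[symmetric])
  then show ?thesis by auto
qed

lemma residues_bij_pos: "bij_betw (\<lambda>i. w i mod (m + 1)) {1..m} {1..m}"
proof -
  have "bij_betw (\<lambda>i. w i mod (m + 1)) ({..m} - {0}) ({..m} - {0})"
    using bij_betw_DiffI[OF residues_bij, of "{0}" "{0}"] w_0 by (simp add: bij_betw_def)
  moreover have "{..m} - {0} = {1..m}" by auto
  ultimately show ?thesis by simp
qed

lemma finite_gaps: "finite (UNIV - S)"
proof (rule finite_subset)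
  show "UNIV - S \<subseteq> {..w m}"
  proof
    fix s assume "s \<in> UNIV - S"
    moreover obtain k where "k \<le> m" "s mod (m + 1) = w k mod (m + 1)"
      using ex_index_of_residue by blast
    moreover from this(1) have "w k \<le> w m"
      using w_less_iff[of m k] by simp
    ultimately show "s \<in> {..w m}"
      using mem_iff_residue[of k s] by simp
  qed
qed simp

lemma infinite_S: "infinite S"
  using finite_gaps by (metis finite_Diff2 infinite_UNIV_nat)

lemma Apery_eq: "Apery S (m + 1) = w ` {..m}"
proof (intro set_eqI)
  fix s
  obtain k where k: "k \<le> m" "s mod (m + 1) = w k mod (m + 1)"
    using ex_index_of_residue by blast
  \<comment> \<open>In terms of the representative \<open>w k\<close> of its class, subtracting \<open>m + 1\<close>
    from \<open>s\<close> stays in \<open>S\<close> exactly from the second element of the class on.\<close>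
  have shift: "int s - int (m + 1) \<in> int ` S \<longleftrightarrow> w k + (m + 1) \<le> s"
  proof (cases "m + 1 \<le> s")
    case True
    then have "(s - (m + 1)) mod (m + 1) = w k mod (m + 1)"
      using k by (metis le_mod_geq)
    then have "s - (m + 1) \<in> S \<longleftrightarrow> w k \<le> s - (m + 1)"
      using mem_iff_residue k by blast
    moreover have "int s - int (m + 1) = int (s - (m + 1))"
      using True by simp
    then have "int s - int (m + 1) \<in> int ` S \<longleftrightarrow> s - (m + 1) \<in> S"
      by (simp only: inj_image_mem_iff[OF inj_of_nat])
    ultimately show ?thesis
      using True by linarith
  qed auto
  have "s \<in> Apery S (m + 1) \<longleftrightarrow> w k \<le> s \<and> s < w k + (m + 1)"
    using shift mem_iff_residue[OF k] by (auto simp: Apery_def)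
  also have "\<dots> \<longleftrightarrow> s = w k"
  proof
    assume A: "w k \<le> s \<and> s < w k + (m + 1)"
    then have "(m + 1) dvd s - w k"
      using k(2) by (metis mod_eq_dvd_iff_nat)
    then show "s = w k" using A nat_dvd_not_less[of "s - w k" "m + 1"] by linarith
  qed auto
  also have "\<dots> \<longleftrightarrow> s \<in> w ` {..m}"
    using k same_residue_iff by auto
  finally show "s \<in> Apery S (m + 1) \<longleftrightarrow> s \<in> w ` {..m}" .
qed

text \<open>The position of an element is the number of elements below it, and these positions inherit the
  order of the list.\<close>

lemma Apery_index_eq_card:
  assumes "i \<le> m"
  shows "Apery_index S (m + 1) i = card {s \<in> S. s < w i}"
proof -
  define f where "f i = card {s \<in> S. s < w i}" for i
  have in_S: "w i \<in> S" if "i \<le> m" for i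
    using that mem_iff_residue by auto
  have f: "enumerate S k = w i \<longleftrightarrow> k = f i" if "i \<le> m" for k i
  proof
    show "enumerate S k = w i \<Longrightarrow> k = f i"
      using card_below_enumerate[OF infinite_S, of k] by (simp add: f_def)
    obtain l where "enumerate S l = w i"
      using enumerate_Ex[OF infinite_S in_S] \<open>i \<le> m\<close> by blast
    then show "k = f i \<Longrightarrow> enumerate S k = w i"
      using card_below_enumerate[OF infinite_S, of l] by (simp add: f_def)
  qed
  have "Apery_positions S (m + 1) = f ` {..m}"
    unfolding Apery_positions_def Apery_eq by (auto simp: image_iff f)
  moreover have "strict_mono_on {..m} f"
  proof (intro strict_mono_onI)
    fix x y assume xy: "x \<in> {..m}" "y \<in> {..m}" "x < y"
    then have "enumerate S (f x) < enumerate S (f y)"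
      using f[of x "f x"] f[of y "f y"] w_less_iff[of x y] by simp
    then show "f x < f y" using infinite_S by simp
  qed
  ultimately have "Apery_index S (m + 1) i = f i"
    using enumerate_strict_mono_image[of m f i] assms by (simp only: Apery_index_def)
  then show ?thesis
    by (simp only: f_def)
qed

lemma Apery_index_formula:
  assumes "i \<le> m"
  shows "int (Apery_index S (m + 1) i) =
    int i * int (w i div (m + 1)) - (\<Sum>k<i. int (w k div (m + 1)))
      + int (card {k. k < i \<and> w k mod (m + 1) < w i mod (m + 1)})"
proof -
  \<comment> \<open>The elements below \<open>w i\<close> lie in the progressions that start at the earlier \<open>w k\<close>.\<close>
  have "{s \<in> S. s < w i} = (\<Union>k<i. (\<lambda>c. w k + c * (m + 1)) ` {c. w k + c * (m + 1) < w i})" (is "_ = (\<Union>k<i. ?B k)")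
  proof -
    have "k < i" if "k \<le> m" "w k + c * (m + 1) < w i" for k c
    proof -
      have "w k < w i" using that(2) by linarith
      then show ?thesis using w_less_iff that(1) assms by blast
    qed
    then have "s \<in> S \<and> s < w i \<longleftrightarrow> (\<exists>k<i. \<exists>c. s = w k + c * (m + 1) \<and> w k + c * (m + 1) < w i)" for s
      unfolding mem_iff using assms by (metis less_imp_le_nat order.strict_trans2)
    then show ?thesis
      by blast
  qed
  moreover have "card (\<Union>k<i. ?B k) = (\<Sum>k<i. card (?B k))"
  proof (intro card_UN_disjoint ballI impI)
    fix k assume "k \<in> {..<i}"
    show "finite (?B k)"
      by (rule finite_subset[of _ "{..<w i}"]) auto
  next
    fix k l assume kl: "k \<in> {..<i}" "l \<in> {..<i}" "k \<noteq> l"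
    have "(w k + c * (m + 1)) \<noteq> (w l + d * (m + 1))" for c d
    proof
      assume "(w k + c * (m + 1)) = (w l + d * (m + 1))"
      then have "w k mod (m + 1) = w l mod (m + 1)" by (metis mod_mult_self1)
      then show False using same_residue_iff kl assms by simp
    qed
    then show "?B k \<inter> ?B l = {}" by blast
  qed simp
  moreover have "int (card (?B k)) = int (w i div (m + 1)) - int (w k div (m + 1))
      + (if w k mod (m + 1) < w i mod (m + 1) then 1 else 0)" if "k < i" for k
  proof -
    have "card (?B k) = card {c. w k + c * (m + 1) < w i}"
      by (intro card_image) (auto simp: inj_on_def simp del: mult_Suc_right)
    then show ?thesis
      using card_progression_below[of "w k" "w i" "m + 1"] w_less_iff that assms by simp
  qed
  ultimately have "int (card {s \<in> S. s < w i}) = (\<Sum>k<i. int (w i div (m + 1)) - int (w k div (m + 1))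
      + (if w k mod (m + 1) < w i mod (m + 1) then 1 else 0))"
    by simp
  also have "\<dots> = int i * int (w i div (m + 1)) - (\<Sum>k<i. int (w k div (m + 1)))
      + int (card ({..<i} \<inter> {k. w k mod (m + 1) < w i mod (m + 1)}))"
    by (simp add: sum.distrib sum_subtractf sum.If_cases)
  also have "{..<i} \<inter> {k. w k mod (m + 1) < w i mod (m + 1)} = {k. k < i \<and> w k mod (m + 1) < w i mod (m + 1)}"
    by auto
  finally show ?thesis
    using Apery_index_eq_card[OF assms] by simp
qed

text \<open>The index 0, with residue 0, counts here but not in the conversion vector.\<close>

lemma card_smaller_residues:
  assumes "1 \<le> i" "i \<le> m"
  shows "card {k. k < i \<and> w k mod (m + 1) < w i mod (m + 1)} =
    Suc (conversion_vector (\<lambda>i. w i mod (m + 1)) i)"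
proof -
  have "w i mod (m + 1) > 0"
    using same_residue_iff[of i 0] assms w_0 by simp
  then have "{k. k < i \<and> w k mod (m + 1) < w i mod (m + 1)} =
      insert 0 {j. 1 \<le> j \<and> j < i \<and> w j mod (m + 1) < w i mod (m + 1)}"
    using assms w_0 by (auto simp: Suc_le_eq)
  moreover have "finite {j. 1 \<le> j \<and> j < i \<and> w j mod (m + 1) < w i mod (m + 1)}"
    by (rule finite_subset[of _ "{..<i}"]) auto
  ultimately show ?thesis
    by (simp add: conversion_vector_def)
qed

lemma position_vector_1:
  assumes "1 \<le> m"
  shows "position_vector S (m + 1) 1 = w 1 div (m + 1) + 1"
proof -
  have "conversion_vector p 1 = 0" for p
    by (auto simp: conversion_vector_def)
  then have "int (Apery_index S (m + 1) 1) = int (w 1 div (m + 1)) + 1"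
    using Apery_index_formula[of 1] card_smaller_residues[of 1] assms w_0 by simp
  moreover have "int (Apery_index S (m + 1) 0) = 0"
    using Apery_index_formula[of 0] by simp
  ultimately show ?thesis
    by (simp add: position_vector_def)
qed

text \<open>The sums over earlier quotients in consecutive positions differ only by the last term, which turns
  the multiple \<open>(i - 1)\<close> of the previous quotient into \<open>i\<close>.\<close>

lemma position_vector_step:
  assumes "2 \<le> i" "i \<le> m"
  shows "int (position_vector S (m + 1) i) =
    int i * (int (w i div (m + 1)) - int (w (i - 1) div (m + 1)))
      + int (conversion_vector (\<lambda>i. w i mod (m + 1)) i)
      - int (conversion_vector (\<lambda>i. w i mod (m + 1)) (i - 1))"
proof -
  obtain k where k: "i = Suc k" "1 \<le> k"
    using assms by (cases i) auto
  \<comment> \<open>Monotonicity makes the truncated difference in the position vector a true one.\<close>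
  have "card {s \<in> S. s < w k} \<le> card {s \<in> S. s < w i}"
    using w_less_iff[of k i] assms k by (intro card_mono) auto
  then have "Apery_index S (m + 1) k \<le> Apery_index S (m + 1) i"
    using Apery_index_eq_card assms k by simp
  then have "int (position_vector S (m + 1) i) =
      int (Apery_index S (m + 1) i) - int (Apery_index S (m + 1) k)"
    by (simp add: position_vector_def k)
  then show ?thesis
    using Apery_index_formula[of i] Apery_index_formula[of k]
      card_smaller_residues[of i] card_smaller_residues[of k] assms k
    by (simp add: algebra_simps)
qed

subsection \<open>From the position vector to the list and back\<close>

lemma conversion_vector_of_position_vector:
  assumes "1 \<le> m" and v: "\<And>i. i \<in> {1..m} \<Longrightarrow> v i = position_vector S (m + 1) i"
    and "1 \<le> i" "i \<le> m"
  shows "conversion_vector (\<lambda>i. w i mod (m + 1)) i = class_vector v i"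
proof (rule class_vector_unique[OF assms(1) _ _ assms(3,4)])
  show "conversion_vector (\<lambda>i. w i mod (m + 1)) 1 = 0"
    using conversion_vector_le[of 1 "\<lambda>i. w i mod (m + 1)"] by simp
next
  fix i assume i: "2 \<le> i" "i \<le> m"
  let ?r = "conversion_vector (\<lambda>i. w i mod (m + 1))"
  have "?r i \<le> i - 1"
    using conversion_vector_le i by simp
  then have "?r i < i" using i by linarith
  moreover have "int (v i + ?r (i - 1)) = int (?r i) + int i * (int (w i div (m + 1)) - int (w (i - 1) div (m + 1)))"
    using position_vector_step[OF i] v[of i] i by simp
  then have "[int (v i + ?r (i - 1)) = int (?r i)] (mod int i)"
    by (simp only: cong_def mod_mult_self2)
  then have "[v i + ?r (i - 1) = ?r i] (mod i)"
    by (simp only: cong_int_iff)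
  ultimately show "?r i < i \<and> [v i + ?r (i - 1) = ?r i] (mod i)" ..
qed

text \<open>The position vector determines the list, residues through the permutation and quotients through
  the levels.\<close>

lemma coordinates_of_position_vector:
  assumes "1 \<le> m" and \<pi>: "in_permutation_class m v \<pi>"
    and v: "\<And>i. i \<in> {1..m} \<Longrightarrow> v i = position_vector S (m + 1) i"
    and "1 \<le> i" "i \<le> m"
  shows "w i mod (m + 1) = \<pi> i" "int (w i div (m + 1)) = level v \<pi> i"
proof -
  let ?p = "\<lambda>i. w i mod (m + 1)"
  have p: "?p i = \<pi> i" if "i \<in> {1..m}" for i
  proof (rule conversion_vector_determines_permutation[OF residues_bij_pos _ _ that])
    show "bij_betw \<pi> {1..m} {1..m}"
      using \<pi> permutes_imp_bij by (auto simp: in_permutation_class_def)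
    show "conversion_vector ?p i = conversion_vector \<pi> i" if "i \<in> {1..m}" for i
      using that conversion_vector_of_position_vector[OF assms(1) v, of i] \<pi>
      by (simp add: in_permutation_class_def)
  qed
  then show "w i mod (m + 1) = \<pi> i" using assms(4,5) by simp
  have step: "int (w i div (m + 1)) - int (w (i - 1) div (m + 1)) = u_quot v i + gamma_descent \<pi> i"
    if i: "1 \<le> i" "i \<le> m" for i
  proof (cases "i = 1")
    case True
    then show ?thesis
      using position_vector_1[OF assms(1)] v[of 1] assms(1) w_0 u_quot_1[of v] gamma_descent_1[of \<pi>]
      by simp
  next
    case False
    then have i2: "2 \<le> i" using i by simp
    have "?p (i - 1) \<noteq> ?p i"
      using same_residue_iff[of "i - 1" i] i by simp
    from quotient_step[where p = ?p and v = v, OF i2 this]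
    have "u_quot v i + gamma_descent ?p i = int (w i div (m + 1)) - int (w (i - 1) div (m + 1))"
      using position_vector_step[OF i2 i(2)] v[of i] i by simp
    moreover have "i \<in> {1..m}" "i - 1 \<in> {1..m}"
      using i i2 by auto
    then have "gamma_descent ?p i = gamma_descent \<pi> i"
      unfolding gamma_descent_def by (simp only: p)
    ultimately show ?thesis by simp
  qed
  show "int (w i div (m + 1)) = level v \<pi> i"
    by (rule level_unique[where m = m and f = "\<lambda>i. int (w i div (m + 1))"])
      (use step w_0 assms(5) in simp_all)
qed

lemma position_vector_of_coordinates:
  assumes "1 \<le> m" and \<pi>: "in_permutation_class m v \<pi>"
    and p: "\<And>i. i \<le> m \<Longrightarrow> w i mod (m + 1) = \<pi> i"
    and q: "\<And>i. i \<le> m \<Longrightarrow> int (w i div (m + 1)) = level v \<pi> i"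
    and i: "1 \<le> i" "i \<le> m"
  shows "v i = position_vector S (m + 1) i"
proof (cases "i = 1")
  case True
  have "level v \<pi> 1 = int (v 1) - 1"
    using level_step[of 1 v \<pi>] u_quot_1[of v] gamma_descent_1[of \<pi>] by simp
  then have "int (position_vector S (m + 1) 1) = int (v 1)"
    using position_vector_1[OF assms(1)] q[of 1] assms(1) by simp
  then show ?thesis using True by simp
next
  case False
  then have i2: "2 \<le> i" using i by simp
  let ?p = "\<lambda>i. w i mod (m + 1)"
  have conv: "conversion_vector ?p k = conversion_vector \<pi> k" if "1 \<le> k" "k \<le> m" for k
    using conversion_vector_cong[of k ?p \<pi>] p that by simp
  obtain a where a: "int (v i) = int i * a + int (conversion_vector \<pi> i) - int (conversion_vector \<pi> (i - 1))"
    using entry_of_permutation_class[OF \<pi> i2 i(2)] by blast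
  have ne: "\<pi> (i - 1) \<noteq> \<pi> i"
    using same_residue_iff[of "i - 1" i] p[of i] p[of "i - 1"] i by simp
  then have "a = level v \<pi> i - level v \<pi> (i - 1)"
    using quotient_step[where p = \<pi> and v = v, OF i2 ne a] level_step[OF i(1), of v \<pi>] by simp
  then have "int (v i) = int (position_vector S (m + 1) i)"
    using a position_vector_step[OF i2 i(2)] q[of i] q[of "i - 1"] conv[of i] conv[of "i - 1"] i i2
    by simp
  then show ?thesis by simp
qed

subsection \<open>Closure under addition\<close>

lemma numerical_semigroup_iff:
  "numerical_semigroup S \<longleftrightarrow>
    (\<forall>i j l. 1 \<le> i \<and> i \<le> j \<and> j < l \<and> l \<le> m \<and> [w i + w j = w l] (mod (m + 1)) \<longrightarrow> w l \<le> w i + w j)"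
    (is "_ \<longleftrightarrow> ?C")
proof
  assume S: "numerical_semigroup S"
  show ?C
  proof (intro allI impI)
    fix i j l
    assume A: "1 \<le> i \<and> i \<le> j \<and> j < l \<and> l \<le> m \<and> [w i + w j = w l] (mod (m + 1))"
    then have "w i \<in> S" "w j \<in> S"
      using mem_iff_residue[of i "w i"] mem_iff_residue[of j "w j"] by simp_all
    then have "w i + w j \<in> S"
      using S by (simp add: numerical_semigroup_def)
    then show "w l \<le> w i + w j"
      using mem_iff_residue A unfolding cong_def by blast
  qed
next
  assume C: ?C
  \<comment> \<open>If \<open>l \<le> j\<close>, then \<open>w l \<le> w j\<close> by monotonicity, and \<open>i = 0\<close> forces \<open>l = j\<close>; the other triples
    are those of the assumption.\<close>
  have key: "w i + w j + c * (m + 1) \<in> S" if "i \<le> j" "j \<le> m" for i j c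
  proof -
    obtain l where l: "l \<le> m" "(w i + w j) mod (m + 1) = w l mod (m + 1)"
      using ex_index_of_residue by blast
    have "w l \<le> w i + w j"
    proof (cases "j < l")
      case True
      have "i \<noteq> 0"
      proof
        assume "i = 0"
        then have "j = l" using l w_0 same_residue_iff[of j l] that by simp
        then show False using True by simp
      qed
      then show ?thesis using C l True that by (auto simp: cong_def)
    next
      case False
      then have "w l \<le> w j" using w_less_iff[of j l] that l by simp
      then show ?thesis by simp
    qed
    moreover have "(w i + w j + c * (m + 1)) mod (m + 1) = w l mod (m + 1)"
      by (simp only: mod_mult_self1 l(2))
    ultimately show ?thesis
      using mem_iff_residue[OF l(1), of "w i + w j + c * (m + 1)"] by simp
  qed
  have "a + b \<in> S" if ab: "a \<in> S" "b \<in> S" for a b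
  proof -
    obtain i c j d where w: "i \<le> m" "j \<le> m" "a = w i + c * (m + 1)" "b = w j + d * (m + 1)"
      using ab mem_iff by meson
    have "a + b = w i + w j + (c + d) * (m + 1)" "a + b = w j + w i + (c + d) * (m + 1)"
      by (simp_all add: w algebra_simps)
    then show ?thesis
      using key[of i j "c + d"] key[of j i "c + d"] w(1,2) by (metis nat_le_linear)
  qed
  moreover have "0 \<in> S"
    using mem_iff_residue[of 0 0] w_0 by simp
  ultimately show "numerical_semigroup S"
    using finite_gaps by (simp add: numerical_semigroup_def)
qed

text \<open>The criterion above, divided by \<open>m + 1\<close>: the sum up to \<open>i\<close> is the level of \<open>i\<close>, and the sum from
  \<open>j + 1\<close> to \<open>l\<close> is the difference of two levels.\<close>

lemma numerical_semigroup_iff_levels: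
  assumes p: "\<And>i. 1 \<le> i \<Longrightarrow> i \<le> m \<Longrightarrow> w i mod (m + 1) = \<pi> i"
    and q: "\<And>i. 1 \<le> i \<Longrightarrow> i \<le> m \<Longrightarrow> int (w i div (m + 1)) = level v \<pi> i"
  shows "numerical_semigroup S \<longleftrightarrow>
     (\<forall>i j l. 1 \<le> i \<and> i \<le> j \<and> j < l \<and> l \<le> m \<and> [\<pi> i + \<pi> j = \<pi> l] (mod (m + 1)) \<longrightarrow>
        real_of_int (\<Sum>x = 1..i. u_quot v x + gamma_descent \<pi> x)
          + (real (\<pi> i) + real (\<pi> j) - real (\<pi> l)) / real (m + 1)
        \<ge> real_of_int (\<Sum>x = j + 1..l. u_quot v x + gamma_descent \<pi> x))"
proof -
  have w: "real (w i) = real (m + 1) * real_of_int (level v \<pi> i) + real (\<pi> i)" if "1 \<le> i" "i \<le> m" for i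
  proof -
    have "real (w i) = real ((m + 1) * (w i div (m + 1)) + w i mod (m + 1))"
      by (simp only: mult_div_mod_eq)
    also have "\<dots> = real (m + 1) * real_of_int (int (w i div (m + 1))) + real (w i mod (m + 1))"
      by (simp only: of_nat_add of_nat_mult of_int_of_nat_eq)
    finally show ?thesis by (simp only: p[OF that] q[OF that])
  qed
  have "[w i + w j = w l] (mod (m + 1)) \<longleftrightarrow> [\<pi> i + \<pi> j = \<pi> l] (mod (m + 1))"
    if "1 \<le> i" "i \<le> j" "j < l" "l \<le> m" for i j l
  proof -
    have "[w k = \<pi> k] (mod (m + 1))" if "1 \<le> k" "k \<le> m" for k
      unfolding cong_def p[OF that, symmetric] by (simp only: mod_mod_trivial)
    then show ?thesis
      using that by (meson cong_add cong_sym cong_trans less_imp_le order.trans)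
  qed
  moreover have "w l \<le> w i + w j \<longleftrightarrow>
        real_of_int (\<Sum>x = 1..i. u_quot v x + gamma_descent \<pi> x)
          + (real (\<pi> i) + real (\<pi> j) - real (\<pi> l)) / real (m + 1)
        \<ge> real_of_int (\<Sum>x = j + 1..l. u_quot v x + gamma_descent \<pi> x)"
    if "1 \<le> i" "i \<le> j" "j < l" "l \<le> m" for i j l
  proof -
    let ?L = "\<lambda>i. real_of_int (level v \<pi> i)"
    define n where "n = real (m + 1)"
    have "n > 0" by (simp add: n_def)
    have "w l \<le> w i + w j \<longleftrightarrow> real (w l) \<le> real (w i) + real (w j)"
      by linarith
    also have "\<dots> \<longleftrightarrow> n * (?L l - ?L j) \<le> n * ?L i + (real (\<pi> i) + real (\<pi> j) - real (\<pi> l))"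
      using w[of i] w[of j] w[of l] that unfolding n_def[symmetric] by (simp add: algebra_simps)
    also have "\<dots> \<longleftrightarrow> ?L l - ?L j \<le> ?L i + (real (\<pi> i) + real (\<pi> j) - real (\<pi> l)) / n"
      using \<open>n > 0\<close> by (simp add: field_simps)
    also have "?L l - ?L j = real_of_int (\<Sum>x = j + 1..l. u_quot v x + gamma_descent \<pi> x)"
      using sum_eq_level_diff[of j l v \<pi>] that by simp
    finally show ?thesis unfolding n_def level_def by simp
  qed
  ultimately show ?thesis
    unfolding numerical_semigroup_iff by blast
qed

end

section \<open>Existence of lists\<close>

lemma ex_apery_list:
  assumes S: "numerical_semigroup S" and n_in: "m + 1 \<in> S"
  shows "\<exists>w. apery_list m w S"
proof -
  \<comment> \<open>The least element of each residue class; a class meets \<open>S\<close> because it is infinite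
    and only finitely many numbers are missing.\<close>
  define K where "K r = (LEAST s. s \<in> S \<and> s mod (m + 1) = r)" for r
  have ex: "\<exists>s. s \<in> S \<and> s mod (m + 1) = r" if "r \<le> m" for r
  proof (rule ccontr)
    assume none: "\<nexists>s. s \<in> S \<and> s mod (m + 1) = r"
    have "range (\<lambda>c. r + c * (m + 1)) \<subseteq> UNIV - S"
    proof (rule image_subsetI)
      fix c
      have "(r + c * (m + 1)) mod (m + 1) = r"
        using that by (simp only: mod_mult_self1) simp
      then show "r + c * (m + 1) \<in> UNIV - S" using none by blast
    qed
    then have "finite (range (\<lambda>c. r + c * (m + 1)))"
      using S finite_subset by (auto simp: numerical_semigroup_def)
    moreover have "inj (\<lambda>c. r + c * (m + 1))"
      by (auto simp: inj_on_def simp del: mult_Suc_right add_Suc_right)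
    ultimately show False
      using finite_imageD infinite_UNIV_nat by blast
  qed
  have K: "K r \<in> S" "K r mod (m + 1) = r" if "r \<le> m" for r
    using LeastI_ex[OF ex[OF that]] by (simp_all only: K_def)
  have K_le: "K (s mod (m + 1)) \<le> s" if "s \<in> S" for s
    unfolding K_def using that by (intro Least_le) simp
  define w where "w = enumerate (K ` {..m})"
  have "inj_on K {..m}"
    using K(2) by (metis atMost_iff inj_onI)
  then have card: "card (K ` {..m}) = Suc m"
    by (simp add: card_image)
  have bij: "bij_betw w {..m} (K ` {..m})"
    using finite_bij_enumerate[of "K ` {..m}"] card by (simp add: w_def lessThan_Suc_atMost)
  have mono: "strict_mono_on {..m} w"
    by (intro strict_mono_onI) (simp add: w_def finite_enumerate_mono card)
  have shift: "s + c * (m + 1) \<in> S" if "s \<in> S" for s c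
  proof (induction c)
    case (Suc c)
    then have "(s + c * (m + 1)) + (m + 1) \<in> S"
      using S n_in unfolding numerical_semigroup_def by blast
    then show ?case by (simp add: algebra_simps)
  qed (use that in simp)
  have "apery_list m w S"
  proof
    have "K 0 = 0"
      using K_le[of 0] S by (simp add: numerical_semigroup_def)
    then have "0 \<in> w ` {..m}"
      using bij unfolding bij_betw_def by (metis atMost_iff image_eqI le0)
    then obtain k where "k \<le> m" "w k = 0" by auto
    then show "w 0 = 0"
      using strict_mono_on_leD[OF mono, of 0 k] by simp
  next
    have "bij_betw (\<lambda>s. s mod (m + 1)) (K ` {..m}) {..m}"
      by (rule bij_betw_byWitness[where f' = K]) (use K(2) in \<open>auto simp del: mod_Suc\<close>)
    then show "bij_betw (\<lambda>i. w i mod (m + 1)) {..m} {..m}"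
      using bij_betw_trans[OF bij] by (simp add: comp_def)
  next
    fix s
    show "s \<in> S \<longleftrightarrow> (\<exists>k\<le>m. \<exists>c. s = w k + c * (m + 1))"
    proof
      assume "s \<in> S"
      define r where "r = s mod (m + 1)"
      have r: "r \<le> m"
        by (simp add: r_def less_Suc_eq_le[symmetric])
      have "K r \<le> s" "s mod (m + 1) = K r mod (m + 1)"
        using K_le[OF \<open>s \<in> S\<close>] K(2)[OF r] by (simp_all only: r_def)
      then obtain c where "s - K r = (m + 1) * c"
        by (metis mod_eq_dvd_iff_nat dvdE)
      then have "s = K r + c * (m + 1)"
        using \<open>K r \<le> s\<close> by (simp add: mult.commute)
      moreover obtain k where "k \<le> m" "w k = K r"
      proof -
        have "K r \<in> w ` {..m}"
          using bij_betw_imp_surj_on[OF bij] r by simp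
        then show thesis using that by auto
      qed
      ultimately have "s = w k + c * (m + 1)" by simp
      then show "\<exists>k\<le>m. \<exists>c. s = w k + c * (m + 1)"
        using \<open>k \<le> m\<close> by blast
    next
      assume "\<exists>k\<le>m. \<exists>c. s = w k + c * (m + 1)"
      then obtain k c where "k \<le> m" "s = w k + c * (m + 1)" by blast
      moreover have "w k \<in> S"
        using bij_betw_apply[OF bij, of k] K(1) \<open>k \<le> m\<close> by auto
      ultimately show "s \<in> S" using shift by simp
    qed
  qed (fact mono)
  then show ?thesis by blast
qed

text \<open>The list that position vectors force on \<open>v\<close> and \<open>\<pi>\<close> is increasing because levels never decrease for
  positive entries and the descent indicator raises the level wherever the residue drops.\<close>

lemma ex_apery_list_of_levels:
  assumes "\<And>i. i \<in> {1..m} \<Longrightarrow> v i > 0" and \<pi>: "\<pi> permutes {1..m}"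
  shows "\<exists>w S. apery_list m w S \<and>
    (\<forall>i\<le>m. w i mod (m + 1) = \<pi> i \<and> int (w i div (m + 1)) = level v \<pi> i)"
proof -
  \<comment> \<open>Quotient and residue are prescribed. At index 0 both vanish, since \<open>\<pi>\<close> fixes
    0.\<close>
  define w where "w i = nat (level v \<pi> i) * (m + 1) + \<pi> i" for i
  define S where "S = {s. \<exists>k\<le>m. \<exists>c. s = w k + c * (m + 1)}"
  have \<pi>_0: "\<pi> 0 = 0"
    using \<pi> by (simp add: permutes_not_in)
  have bij: "bij_betw \<pi> {..m} {..m}"
    using permutes_imp_bij[OF permutes_subset[OF \<pi>]] by auto
  then have \<pi>_le: "\<pi> i \<le> m" if "i \<le> m" for i
    using that by (auto dest: bij_betwE)
  have nonneg: "i \<le> m \<Longrightarrow> 0 \<le> level v \<pi> i" for i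
  proof (induction i)
    case (Suc i)
    then show ?case using level_increment(1)[of v "Suc i" \<pi>] assms(1)[of "Suc i"] by simp
  qed simp
  have mod: "w i mod (m + 1) = \<pi> i" if "i \<le> m" for i
    using \<pi>_le[OF that] unfolding w_def by (simp only: mod_mult_self3) simp
  have div: "w i div (m + 1) = nat (level v \<pi> i)" if "i \<le> m" for i
    using \<pi>_le[OF that] unfolding w_def by (subst div_mult_self3) simp_all
  \<comment> \<open>A level that stays constant across a step excludes a descent there, so the residue grows.\<close>
  have step: "w i < w (Suc i)" if "Suc i \<le> m" for i
  proof -
    have "\<pi> i \<noteq> \<pi> (Suc i)"
      using bij_betw_imp_inj_on[OF bij] that by (auto dest: inj_onD)
    moreover have "\<not> \<pi> (Suc i) < \<pi> i" if "i = 0"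
      using that \<pi>_0 by simp
    moreover have "level v \<pi> i \<le> level v \<pi> (Suc i)"
      using level_increment(1)[of v "Suc i" \<pi>] assms(1)[of "Suc i"] that by simp
    moreover have "level v \<pi> i < level v \<pi> (Suc i)" if "\<pi> (Suc i) < \<pi> i" "i \<noteq> 0"
      using level_increment(2)[of v "Suc i" \<pi>] assms(1)[of "Suc i"] that \<open>Suc i \<le> m\<close> by simp
    ultimately have "level v \<pi> i < level v \<pi> (Suc i) \<or>
        level v \<pi> i = level v \<pi> (Suc i) \<and> \<pi> i < \<pi> (Suc i)"
      by fastforce
    then have "nat (level v \<pi> i) < nat (level v \<pi> (Suc i)) \<or>
        nat (level v \<pi> i) = nat (level v \<pi> (Suc i)) \<and> \<pi> i < \<pi> (Suc i)"
      using nonneg[of i] that by auto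
    moreover have "\<pi> i < m + 1" "\<pi> (Suc i) < m + 1"
      using \<pi>_le[of i] \<pi>_le[OF that] that by simp_all
    ultimately show ?thesis
      unfolding w_def by (simp only: lex_less_iff)
  qed
  have "apery_list m w S"
  proof
    show "w 0 = 0"
      by (simp add: w_def \<pi>_0)
    show "strict_mono_on {..m} w"
    proof (intro strict_mono_onI)
      fix i j assume ij: "i \<in> {..m}" "j \<in> {..m}" "i < j"
      show "w i < w j"
        by (rule lift_Suc_mono_less_ivl[where N = "{..<m}"]) (use ij step in auto)
    qed
    show "bij_betw (\<lambda>i. w i mod (m + 1)) {..m} {..m}"
      using bij mod bij_betw_cong[of "{..m}" "\<lambda>i. w i mod (m + 1)" \<pi>] by simp
    show "s \<in> S \<longleftrightarrow> (\<exists>k\<le>m. \<exists>c. s = w k + c * (m + 1))" for s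
      by (simp only: S_def mem_Collect_eq)
  qed
  then show ?thesis
    using mod div nonneg by (intro exI[of _ w] exI[of _ S]) simp
qed

section \<open>The characterization\<close>

theorem theorem3p5:
  fixes m :: nat and v \<pi> :: "nat \<Rightarrow> nat"
  assumes "m \<ge> 1"
    and "\<And>i. i \<in> {1..m} \<Longrightarrow> v i > 0"
    and "in_permutation_class m v \<pi>"
  shows "(\<exists>S. numerical_semigroup S \<and> m + 1 \<in> S \<and>
              (\<forall>i\<in>{1..m}. v i = position_vector S (m + 1) i))
     \<longleftrightarrow>
     (\<forall>i j l. 1 \<le> i \<and> i \<le> j \<and> j < l \<and> l \<le> m \<and> [\<pi> i + \<pi> j = \<pi> l] (mod (m + 1)) \<longrightarrow>
        real_of_int (\<Sum>x = 1..i. u_quot v x + gamma_descent \<pi> x)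
          + (real (\<pi> i) + real (\<pi> j) - real (\<pi> l)) / real (m + 1)
        \<ge> real_of_int (\<Sum>x = j + 1..l. u_quot v x + gamma_descent \<pi> x))"
    (is "?realizable \<longleftrightarrow> ?inequalities")
proof
  assume ?realizable
  then obtain S where S: "numerical_semigroup S" "m + 1 \<in> S"
    and v: "\<And>i. i \<in> {1..m} \<Longrightarrow> v i = position_vector S (m + 1) i"
    by blast
  obtain w where "apery_list m w S"
    using ex_apery_list[OF S] by blast
  then interpret apery_list m w S .
  show ?inequalities
    using numerical_semigroup_iff_levels[OF coordinates_of_position_vector[OF assms(1,3) v]] S(1)
    by blast
next
  assume ineq: ?inequalities
  have "\<pi> permutes {1..m}"
    using assms(3) by (simp add: in_permutation_class_def)
  then obtain w S where w: "apery_list m w S"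
    and all_coords: "\<forall>i\<le>m. w i mod (m + 1) = \<pi> i \<and> int (w i div (m + 1)) = level v \<pi> i"
    using ex_apery_list_of_levels[of m v \<pi>] assms(2) by blast
  then have coords: "\<And>i. i \<le> m \<Longrightarrow> w i mod (m + 1) = \<pi> i"
      "\<And>i. i \<le> m \<Longrightarrow> int (w i div (m + 1)) = level v \<pi> i"
    by blast+
  interpret apery_list m w S by (fact w)
  have "numerical_semigroup S"
    using numerical_semigroup_iff_levels[OF coords] ineq by blast
  moreover have "m + 1 \<in> S"
    unfolding mem_iff by (intro exI[of _ 0] exI[of _ 1] conjI) (simp_all add: w_0)
  moreover have "v i = position_vector S (m + 1) i" if "i \<in> {1..m}" for i
    using position_vector_of_coordinates[OF assms(1,3) coords, of i] that by simp
  ultimately show ?realizable by blast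
qed

end
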